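(* Let $\nu$ be a positive integer, $\chi$ a Dirichlet character modulo $N$, and $m$ a non-negative integer. Then $$L^{(\nu)}_0(-m,\chi)=0\quad(\chi\neq\mathbf{1}),\qquad \zeta^{(\nu)}_0(-m)=\begin{cases}-1 & (m=0),\\ 0 & (m\neq 0).\end{cases}$$ Further, let $D^{(\nu)}_0=\{s\in\mathbb{C} : \mathrm{Re}(s)\notin\mathbb{Z}_{\le\nu}\}\cup\{0,-1,-2,\ldots\}$. Then for $s\in D^{(\nu)}_0$ one has $$L^{(\nu)}_0(s,\chi)=0\quad(\chi\neq\mathbf{1}),$$ $$\zeta^{(\nu)}_0(s)=\begin{cases}0 & \text{if } \mathrm{Re}(s)>\nu,\\[2pt] -\dfrac{(s+1)_m}{m!} & \text{if } \nu-m-1<\mathrm{Re}(s)<\nu-m\quad(m=0,1,2,\ldots).\end{cases}$$ Moreover, $\lim_{q\downarrow 0}L^{(\nu)}_q(s,\chi)$ does not exist if $s\notin D^{(\nu)}_0$.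
   Context: For $0<q<1$ write $[n]_q=(1-q^n)/(1-q)$ and $q^x=e^{x\log q}$. For a Dirichlet character $\chi$ modulo $N$ and a positive integer $\nu$, $$L^{(\nu)}_q(s,\chi)=\sum_{n=1}^{\infty}\frac{\chi(n)q^{n(s-\nu)}}{[n]_q^{\,s}}\qquad(\mathrm{Re}(s)>\nu),$$ and the same symbol denotes its meromorphic continuation to $s\in\mathbb{C}$. $\mathbf{1}$ is the trivial character (modulus $1$, identically equal to $1$) and $\zeta^{(\nu)}_q(s)=L^{(\nu)}_q(s,\mathbf{1})$. The crystal functions are the pointwise limits $L^{(\nu)}_0(s,\chi)=\lim_{q\downarrow0}L^{(\nu)}_q(s,\chi)$ and $\zeta^{(\nu)}_0(s)=\lim_{q\downarrow0}\zeta^{(\nu)}_q(s)$, at points $s$ where the limit exists. $\mathbb{Z}_{\le\nu}$ is the set of integers $\le\nu$. $(s)_k=s(s+1)\cdots(s+k-1)$, $(s)_0=1$.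
   Formalization: The last sentence is false for non-principal χ at s=1,…,ν (e.g. ν=1, χ the non-principal character mod 4, s=1: the limit is 1/2); non-existence of the limit is stated for all s∉D except these points for non-principal χ. *)

theory Defs
  imports "HOL-Complex_Analysis.Complex_Analysis"
begin

definition dirichlet_character :: "nat \<Rightarrow> (int \<Rightarrow> complex) \<Rightarrow> bool" where
  "dirichlet_character N chi \<longleftrightarrow> N > 0 \<and>
     (\<forall>a b. chi (a * b) = chi a * chi b) \<and>
     (\<forall>a. chi (a + int N) = chi a) \<and>
     (\<forall>a. chi a \<noteq> 0 \<longleftrightarrow> coprime a (int N))"

text \<open>The character of modulus 1. The principal character of a modulus \<open>N > 1\<close> vanishes at 0
  and is therefore different from it.\<close>

definition trivial_character :: "int \<Rightarrow> complex" where
  "trivial_character = (\<lambda>_. 1)"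

definition principal_character :: "nat \<Rightarrow> (int \<Rightarrow> complex) \<Rightarrow> bool" where
  "principal_character N chi \<longleftrightarrow> (\<forall>a. coprime a (int N) \<longrightarrow> chi a = 1)"

definition q_number :: "real \<Rightarrow> nat \<Rightarrow> real" where
  "q_number q n = (1 - q ^ n) / (1 - q)"

definition q_L_series :: "real \<Rightarrow> nat \<Rightarrow> (int \<Rightarrow> complex) \<Rightarrow> complex \<Rightarrow> complex" where
  "q_L_series q \<nu> chi s =
     (\<Sum>k. let n = Suc k in
        chi (int n) * of_real q powr (of_nat n * (s - of_nat \<nu>)) / of_real (q_number q n) powr s)"

text \<open>The meromorphic continuation to the whole plane. Requiring the function to be
  \<^const>\<open>nicely_meromorphic_on\<close> (removable singularities filled in, value 0 at the poles)
  makes it unique as a total function.\<close>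

definition q_L :: "real \<Rightarrow> nat \<Rightarrow> (int \<Rightarrow> complex) \<Rightarrow> complex \<Rightarrow> complex" where
  "q_L q \<nu> chi = (THE f. f nicely_meromorphic_on UNIV \<and>
     (\<forall>s. Re s > real \<nu> \<longrightarrow> f s = q_L_series q \<nu> chi s))"

definition q_zeta :: "real \<Rightarrow> nat \<Rightarrow> complex \<Rightarrow> complex" where
  "q_zeta q \<nu> = q_L q \<nu> trivial_character"

text \<open>\<open>F q\<close> has the limit \<open>l\<close> at the point \<open>s\<close> as \<open>q\<close> decreases to 0. The value 0
  that \<^const>\<open>q_L\<close> takes at a pole is only a convention, so \<open>s\<close> must not be a pole of \<open>F q\<close>
  for small \<open>q\<close>.\<close>

definition has_crystal_limit ::
    "(real \<Rightarrow> complex \<Rightarrow> complex) \<Rightarrow> complex \<Rightarrow> complex \<Rightarrow> bool" where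
  "has_crystal_limit F s l \<longleftrightarrow>
     (\<forall>\<^sub>F q in at_right 0. \<not> is_pole (F q) s) \<and> ((\<lambda>q. F q s) \<longlongrightarrow> l) (at_right 0)"

text \<open>\<open>L_0_is \<nu> chi s l\<close> and \<open>zeta_0_is \<nu> s l\<close> say that the crystal function is defined
  at \<open>s\<close> (the limit exists) and has the value \<open>l\<close> there.\<close>

definition L_0_is :: "nat \<Rightarrow> (int \<Rightarrow> complex) \<Rightarrow> complex \<Rightarrow> complex \<Rightarrow> bool" where
  "L_0_is \<nu> chi s l \<longleftrightarrow> has_crystal_limit (\<lambda>q. q_L q \<nu> chi) s l"

definition zeta_0_is :: "nat \<Rightarrow> complex \<Rightarrow> complex \<Rightarrow> bool" where
  "zeta_0_is \<nu> s l \<longleftrightarrow> has_crystal_limit (\<lambda>q. q_zeta q \<nu>) s l"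

definition crystal_domain :: "nat \<Rightarrow> complex set" where
  "crystal_domain \<nu> =
     {s. Re s \<notin> real_of_int ` {..int \<nu>}} \<union> range (\<lambda>j::nat. - of_nat j)"

text \<open>Points where the limit exists although they lie outside \<^const>\<open>crystal_domain\<close>:
  for a non-principal \<open>chi\<close> and \<open>s = \<nu> - k\<close> with \<open>0 \<le> k < \<nu>\<close>, the function \<open>q_L q \<nu> chi\<close> is
  holomorphic at \<open>s\<close> and tends there to \<open>(s)\<^sub>k / k! \<cdot> L(0, chi)\<close>.
  For instance, for \<open>\<nu> = 1\<close> and the non-principal character modulo 4 the limit at \<open>s = 1\<close>
  is 1/2. Non-existence of the limit can only be claimed away from these points.\<close>

definition exceptional_points :: "nat \<Rightarrow> nat \<Rightarrow> (int \<Rightarrow> complex) \<Rightarrow> complex set" where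
  "exceptional_points \<nu> N chi = (if principal_character N chi then {} else of_nat ` {1..\<nu>})"

end

theory Submission
  imports Defs
begin

text \<open>
  Expanding \<open>(1 - q\<^sup>n)\<^bsup>-s\<^esup>\<close> by the binomial series and summing over \<open>n\<close> first turns the defining
  series into
  \[ L_q(s, \chi) = (1-q)^s \sum_{k \ge 0} \frac{(s)_k}{k!}\, g(q^{s-\nu+k}),
     \qquad g(x) = \sum_{n \ge 1} \chi(n) x^n = \frac{\sum_{n=1}^N \chi(n) x^n}{1-x^N}. \]
  The function \<open>g\<close> is rational, so each term is meromorphic in the whole plane, and far out in the
  sum \<open>g(x) = O(x)\<close> makes the series converge geometrically. So this right-hand side
  (\<open>L_expansion\<close>), with its removable singularities filled in, is the meromorphic continuation
  (\<open>q_L_eq_remove_sings\<close>).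

  The limit \<open>q \<rightarrow> 0\<close> can now be read off term by term. The argument \<open>q\<^bsup>s-\<nu>+k\<^esup>\<close> has modulus
  \<open>q\<^bsup>Re s - \<nu> + k\<^esup>\<close>. If the exponent is positive the argument tends to \<open>0\<close>, where \<open>g\<close> vanishes,
  and this happens uniformly in \<open>k\<close> (\<open>L_tail_tendsto_0\<close>). If it is negative the argument
  tends to infinity, where \<open>g\<close> takes the value \<open>-\<chi>(N)\<close>, which is \<open>-1\<close> for the trivial character and
  \<open>0\<close> for every other one. So off the lines \<open>Re s = \<nu> - K\<close> the limit is \<open>-\<chi>(N)\<close> times a partial sum
  of the coefficients \<open>(s)\<^sub>k / k!\<close>, and such partial sums telescope
  (\<open>crystal_limit_open_strip\<close>, \<open>sum_rising_binomial\<close>).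

  On a line \<open>Re s = \<nu> - K\<close> the term \<open>k = K\<close> evaluates \<open>g\<close> on the unit circle, and everything else
  behaves as before. Three kinds of points have to be considered.
  \<^item> At \<open>s = -m\<close> the coefficient \<open>(s)\<^sub>K / K!\<close> has a zero which cancels the pole of \<open>g\<close> at \<open>1\<close>. What is
    left of the product is a constant multiple of \<open>1 / log q\<close> and disappears in the limit
    (\<open>crystal_limit_nonpos_int\<close>).
  \<^item> If \<open>s\<close> is not real, its argument \<open>q\<^bsup>i Im s\<^esup>\<close> winds around the circle infinitely often as
    \<open>q \<rightarrow> 0\<close>. A limit would force \<open>g\<close> to be constant on the circle
    (\<open>crystal_limit_on_line\<close>), which a polynomial identity excludes
    (\<open>char_gf_not_constant_on_circle\<close>).
  \<^item> If \<open>s\<close> is a positive integer and \<open>\<chi>\<close> is principal, then \<open>\<chi>(1) + \<dots> + \<chi>(N) \<noteq> 0\<close> and the pole of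
    \<open>g\<close> at \<open>1\<close> survives for every \<open>q\<close> (\<open>is_pole_q_L\<close>).
\<close>

section \<open>Binomial coefficients, double series, and uniqueness of continuation\<close>

text \<open>The binomial coefficient with top \<open>s + k - 1\<close> and bottom \<open>k\<close>, written as a rising factorial so that
  its zeros are visibly the integers \<open>0, -1, \<dots>, 1 - k\<close>.\<close>

definition rising_binomial :: "nat \<Rightarrow> 'a::field_char_0 \<Rightarrow> 'a" where
  "rising_binomial k s = pochhammer s k / fact k"

lemma rising_binomial_sums:
  assumes "norm (z::complex) < 1"
  shows "(\<lambda>k. rising_binomial k s * z ^ k) sums (1 - z) powr (- s)"
proof -
  have "(\<lambda>k. (- s gchoose k) * (- z) ^ k) sums (1 + - z) powr (- s)"
    using assms by (intro gen_binomial_complex) simp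
  moreover have "(- s gchoose k) * (- z) ^ k = rising_binomial k s * z ^ k" for k
  proof -
    have "(- s gchoose k) * (- z) ^ k = ((-1) ^ k * (-1) ^ k) * rising_binomial k s * z ^ k"
      unfolding gbinomial_pochhammer rising_binomial_def power_minus[of z] by simp
    also have "(-1) ^ k * (-1) ^ k = (1::complex)"
      by (simp flip: power_add)
    finally show ?thesis by simp
  qed
  ultimately show ?thesis by simp
qed

text \<open>The hockey-stick identity in terms of rising factorials.\<close>

lemma sum_rising_binomial:
  "(\<Sum>k\<le>n. rising_binomial k s) = rising_binomial n (s + 1)"
proof (induction n)
  case (Suc n)
  have "pochhammer s (Suc n) = s * pochhammer (s + 1) n"
    by (rule pochhammer_rec)
  moreover have "pochhammer (s + 1) (Suc n) = pochhammer (s + 1) n * (s + 1 + of_nat n)"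
    by (rule pochhammer_Suc)
  ultimately show ?case
    using Suc by (simp add: rising_binomial_def field_simps del: of_nat_Suc) (simp add: algebra_simps)
qed (simp add: rising_binomial_def)

text \<open>Passing to the real coefficient at a radius \<open>R\<close> gives one majorant for a whole disc of values of
  \<open>s\<close>, as the Weierstrass test requires.\<close>

lemma norm_rising_binomial_le:
  assumes "norm (s::complex) \<le> R"
  shows "norm (rising_binomial k s) \<le> rising_binomial k R"
proof -
  have R: "R \<ge> 0" using assms norm_ge_zero order_trans by blast
  have "norm (pochhammer s k) \<le> pochhammer R k"
  proof (induction k)
    case (Suc k)
    have "norm (s + of_nat k) \<le> R + of_nat k"
      using assms norm_triangle_ineq[of s "of_nat k"] by simp
    from mult_mono[OF Suc this] show ?case
      using order_trans[OF norm_ge_zero Suc] by (simp add: pochhammer_Suc norm_mult)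
  qed simp
  thus ?thesis by (simp add: rising_binomial_def norm_divide divide_right_mono)
qed

lemma summable_rising_binomial_real:
  assumes "\<bar>r\<bar> < 1"
  shows "summable (\<lambda>k. rising_binomial (k + M) (R::real) * r ^ k)"
proof (cases "r = 0")
  case True
  thus ?thesis by (intro summable_finite[of "{0}"]) auto
next
  case False
  have "(\<lambda>k. rising_binomial k (of_real R) * complex_of_real r ^ k)
          = (\<lambda>k. of_real (rising_binomial k R * r ^ k))"
    by (simp add: rising_binomial_def pochhammer_of_real)
  hence "summable (\<lambda>k. complex_of_real (rising_binomial k R * r ^ k))"
    using rising_binomial_sums[of "of_real r" "of_real R"] assms by (simp add: sums_iff)
  hence "summable (\<lambda>k. rising_binomial k R * r ^ k)"
    by (simp only: summable_complex_of_real)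
  hence "summable (\<lambda>k. (1 / r ^ M) * (rising_binomial (k + M) R * r ^ (k + M)))"
    by (intro summable_mult summable_ignore_initial_segment)
  thus ?thesis using False by (simp add: power_add)
qed

text \<open>Fubini for double series whose majorant is a product, so that absolute summability reduces to
  that of the two factors.\<close>

lemma suminf_swap_of_product_bound:
  fixes F :: "nat \<Rightarrow> nat \<Rightarrow> complex"
  assumes le: "\<And>n k. norm (F n k) \<le> A n * B k"
    and A: "summable A" "\<And>n. A n \<ge> 0" and B: "summable B" "\<And>k. B k \<ge> 0"
  shows "(\<Sum>n. \<Sum>k. F n k) = (\<Sum>k. \<Sum>n. F n k)"
proof -
  have to_infsum: "(\<Sum>n. f n) = infsum f UNIV"
    if "summable (\<lambda>n. norm (f n))" for f :: "nat \<Rightarrow> complex"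
  proof -
    from that have "f sums (\<Sum>n. f n)" by (simp add: summable_norm_cancel summable_sums)
    from norm_summable_imp_has_sum[OF that this] show ?thesis by (simp add: infsumI)
  qed
  have row: "summable (\<lambda>k. norm (F n k))" for n
    by (rule summable_comparison_test'[where g = "\<lambda>k. A n * B k"])
       (use le B in \<open>auto intro: summable_mult\<close>)
  have col: "summable (\<lambda>n. norm (F n k))" for k
    by (rule summable_comparison_test'[where g = "\<lambda>n. A n * B k"])
       (use le A in \<open>auto intro: summable_mult2\<close>)
  have row_le: "(\<Sum>k. norm (F n k)) \<le> A n * suminf B" for n
    using suminf_le[OF le row] B by (simp add: suminf_mult summable_mult)
  have col_le: "(\<Sum>n. norm (F n k)) \<le> suminf A * B k" for k
    using suminf_le[OF le col] A by (simp add: summable_mult2 flip: suminf_mult2)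
  have rows: "summable (\<lambda>n. norm (\<Sum>k. F n k))"
    by (rule summable_comparison_test'[where g = "\<lambda>n. A n * suminf B"])
       (use A order_trans[OF summable_norm[OF row] row_le] in \<open>auto intro!: summable_mult2\<close>)
  have cols: "summable (\<lambda>k. norm (\<Sum>n. F n k))"
    by (rule summable_comparison_test'[where g = "\<lambda>k. suminf A * B k"])
       (use B order_trans[OF summable_norm[OF col] col_le] in \<open>auto intro!: summable_mult\<close>)
  have rows_abs: "(\<lambda>k. norm (F n k)) summable_on UNIV" for n
    using row[of n] by (simp add: summable_on_UNIV_nonneg_real_iff)
  have row_infsum: "(\<Sum>\<^sub>\<infinity>k. norm (F n k)) = (\<Sum>k. norm (F n k))" for n
  proof -
    have "(\<lambda>k. norm (F n k)) sums (\<Sum>k. norm (F n k))" by (rule summable_sums[OF row])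
    from norm_summable_imp_has_sum[OF _ this] row show ?thesis by (simp add: infsumI)
  qed
  have row_nonneg: "(\<Sum>k. norm (F n k)) \<ge> 0" for n by (intro suminf_nonneg row) simp
  have "summable (\<lambda>n. \<Sum>k. norm (F n k))"
    by (rule summable_comparison_test'[where g = "\<lambda>n. A n * suminf B"])
       (use A row_le row_nonneg in \<open>auto intro!: summable_mult2\<close>)
  hence "(\<lambda>n. \<Sum>\<^sub>\<infinity>k. norm (F n k)) summable_on UNIV"
    by (simp add: row_infsum row_nonneg summable_on_UNIV_nonneg_real_iff)
  with rows_abs have "(\<lambda>p. norm (case p of (n, k) \<Rightarrow> F n k)) summable_on (UNIV \<times> UNIV)"
    unfolding Infinite_Sum.abs_summable_on_Sigma_iff by (simp add: row_infsum row_nonneg)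
  hence "(\<lambda>(n, k). F n k) summable_on (UNIV \<times> UNIV)" by (rule abs_summable_summable)
  from infsum_swap_banach[OF this]
  show "(\<Sum>n. \<Sum>k. F n k) = (\<Sum>k. \<Sum>n. F n k)"
    by (simp add: to_infsum row col to_infsum[OF rows, simplified to_infsum[OF row]] to_infsum[OF cols, simplified to_infsum[OF col]])
qed

text \<open>The identity theorem. The difference of two such functions need not be \<open>nicely_meromorphic\<close> at
  common poles, so it is made so by removing its singularities. Conversely, a nicely meromorphic
  function is unchanged when its singularities are removed.\<close>

lemma nicely_meromorphic_eqI:
  assumes f: "f nicely_meromorphic_on UNIV" and g: "g nicely_meromorphic_on UNIV"
    and eq: "\<exists>\<^sub>F w in at z. f w = g w"
  shows "f = g"
proof
  fix w
  have m: "f meromorphic_on UNIV" "g meromorphic_on UNIV"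
    using f g by (auto simp: nicely_meromorphic_on_def)
  hence md: "(\<lambda>w. f w - g w) meromorphic_on UNIV" by (intro meromorphic_intros)
  define h where "h = remove_sings (\<lambda>w. f w - g w)"
  have ev: "\<forall>\<^sub>F w in at x. h w = f w - g w" for x
    unfolding h_def using md
    by (intro eventually_remove_sings_eq_at) (metis UNIV_I meromorphic_onE)
  have "\<exists>\<^sub>F w in at z. h w = 0"
    using frequently_eventually_frequently[OF eq ev] by (rule frequently_elim1) auto
  hence "h x = 0" for x
    by (rule frequently_eq_meromorphic_imp_constant[where A = UNIV])
       (use md in \<open>auto simp: h_def intro: remove_sings_nicely_meromorphic\<close>)
  hence "\<forall>\<^sub>F x in at w. f x = g x" using ev[of w] by simp
  hence rs: "remove_sings f w = remove_sings g w" by (intro remove_sings_cong) auto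
  have "remove_sings k w = k w" if "k nicely_meromorphic_on UNIV" for k
    using that unfolding nicely_meromorphic_on_def by (metis UNIV_I remove_sings_at_pole remove_sings_eqI)
  with f g rs show "f w = g w" by metis
qed

section \<open>The generating function of a character and the expansion\<close>

text \<open>The closed form of the generating function \<open>\<Sum>n\<ge>1. \<chi>(n) x\<^sup>n\<close>, valid outside the unit disc as well.\<close>

definition char_gf :: "nat \<Rightarrow> (int \<Rightarrow> complex) \<Rightarrow> complex \<Rightarrow> complex" where
  "char_gf N chi x = (\<Sum>n=1..N. chi (int n) * x ^ n) / (1 - x ^ N)"

definition chi_bound :: "nat \<Rightarrow> (int \<Rightarrow> complex) \<Rightarrow> real" where
  "chi_bound N chi = (\<Sum>r<N. norm (chi (int r)))"

text \<open>The point \<open>q\<^bsup>s-\<nu>+k\<^esup>\<close> at which the \<open>k\<close>-th term of the expansion evaluates the generating function.\<close>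

definition node :: "real \<Rightarrow> nat \<Rightarrow> nat \<Rightarrow> complex \<Rightarrow> complex" where
  "node q \<nu> k s = of_real q powr (s - of_nat \<nu> + of_nat k)"

definition L_term :: "real \<Rightarrow> nat \<Rightarrow> nat \<Rightarrow> (int \<Rightarrow> complex) \<Rightarrow> nat \<Rightarrow> complex \<Rightarrow> complex" where
  "L_term q \<nu> N chi k s = rising_binomial k s * char_gf N chi (node q \<nu> k s)"

definition L_tail :: "real \<Rightarrow> nat \<Rightarrow> nat \<Rightarrow> (int \<Rightarrow> complex) \<Rightarrow> nat \<Rightarrow> complex \<Rightarrow> complex" where
  "L_tail q \<nu> N chi M s = (\<Sum>k. L_term q \<nu> N chi (k + M) s)"

definition L_expansion :: "real \<Rightarrow> nat \<Rightarrow> nat \<Rightarrow> (int \<Rightarrow> complex) \<Rightarrow> complex \<Rightarrow> complex" where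
  "L_expansion q \<nu> N chi s = of_real (1 - q) powr s * L_tail q \<nu> N chi 0 s"

lemma power_ne_1_of_norm_less_1:
  assumes "norm (x::complex) < 1" "N > 0"
  shows "x ^ N \<noteq> 1"
  using power_eq_1_iff[of x N] assms by auto

lemma norm_node:
  assumes "q > 0"
  shows "norm (node q \<nu> k s) = q powr (Re s - real \<nu> + real k)"
  using assms by (simp add: node_def norm_powr_real_powr)

lemma node_eq_geometric:
  assumes "q > 0"
  shows "node q \<nu> k s = of_real q powr (s - of_nat \<nu>) * of_real q ^ k"
  using assms by (simp add: node_def powr_add powr_nat')

lemma node_analytic [analytic_intros]:
  assumes "q > 0"
  shows "node q \<nu> k analytic_on A"
proof -
  have "(\<lambda>s. of_real q powr (s - of_nat \<nu> + of_nat k)) analytic_on A"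
    using assms unfolding powr_def by (auto intro!: analytic_intros)
  thus ?thesis by (simp add: node_def[abs_def])
qed

lemma rising_binomial_analytic [analytic_intros]:
  "rising_binomial k analytic_on A"
proof -
  have "(\<lambda>s::complex. rising_binomial k s) analytic_on A"
    unfolding rising_binomial_def pochhammer_prod by (intro analytic_intros) auto
  thus ?thesis by simp
qed

lemma char_gf_analytic:
  assumes "f analytic_on A" "\<And>z. z \<in> A \<Longrightarrow> f z ^ N \<noteq> 1"
  shows "(\<lambda>z. char_gf N chi (f z)) analytic_on A"
  unfolding char_gf_def using assms by (intro analytic_intros) auto

lemma L_term_analytic:
  assumes "q > 0" "\<And>s. s \<in> A \<Longrightarrow> node q \<nu> k s ^ N \<noteq> 1"
  shows "L_term q \<nu> N chi k analytic_on A"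
proof -
  have "(\<lambda>s. L_term q \<nu> N chi k s) analytic_on A"
    unfolding L_term_def using assms by (intro analytic_intros char_gf_analytic) auto
  thus ?thesis by simp
qed

lemma L_term_meromorphic:
  assumes "q > 0"
  shows "L_term q \<nu> N chi k meromorphic_on A"
proof -
  have "node q \<nu> k meromorphic_on A" "rising_binomial k meromorphic_on A"
    using assms by (auto intro!: analytic_on_imp_meromorphic_on analytic_intros)
  hence "(\<lambda>s. L_term q \<nu> N chi k s) meromorphic_on A"
    unfolding L_term_def char_gf_def by (intro meromorphic_intros)
  thus ?thesis by simp
qed

text \<open>Numerator and denominator both have degree at most \<open>N\<close>, so only the top coefficients \<open>\<chi>(N)\<close> and
  \<open>-1\<close> matter; the proof divides both by \<open>x\<^sup>N\<close> and lets \<open>1/x \<rightarrow> 0\<close>.\<close>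

lemma char_gf_tendsto_at_infinity:
  assumes "N > 0"
  shows "(char_gf N chi \<longlongrightarrow> - chi (int N)) at_infinity"
proof -
  have "((\<lambda>y. (\<Sum>n=1..N. chi (int n) * y ^ (N - n)) / (y ^ N - 1))
          \<longlongrightarrow> (\<Sum>n=1..N. chi (int n) * 0 ^ (N - n)) / (0 ^ N - 1)) (nhds 0)"
    using assms by (intro tendsto_intros) (auto simp: filterlim_ident power_0_left)
  also have "(\<Sum>n=1..N. chi (int n) * 0 ^ (N - n)) = (\<Sum>n\<in>{N}. chi (int n))"
    using assms by (intro sum.mono_neutral_cong_right) auto
  also have "\<dots> / (0 ^ N - 1) = - chi (int N)" using assms by (simp add: power_0_left)
  finally have "((\<lambda>x. (\<Sum>n=1..N. chi (int n) * inverse x ^ (N - n)) / (inverse x ^ N - 1))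
          \<longlongrightarrow> - chi (int N)) at_infinity"
    by (rule filterlim_compose) (rule tendsto_inverse_0)
  moreover have "\<forall>\<^sub>F x in at_infinity.
      (\<Sum>n=1..N. chi (int n) * inverse x ^ (N - n)) / (inverse x ^ N - 1) = char_gf N chi x"
  proof -
    have "\<forall>\<^sub>F x::complex in at_infinity. x \<noteq> 0"
      by (rule eventually_not_equal_at_infinity)
    thus ?thesis
    proof eventually_elim
      case (elim x)
      have "x ^ N * (\<Sum>n=1..N. chi (int n) * inverse x ^ (N - n)) = (\<Sum>n=1..N. chi (int n) * x ^ n)"
        unfolding sum_distrib_left
        by (intro sum.cong refl) (use elim in \<open>auto simp: field_simps simp flip: power_add\<close>)
      moreover have "x ^ N * (inverse x ^ N - 1) = 1 - x ^ N"
        using elim by (simp add: field_simps)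
      ultimately show ?case
        using elim unfolding char_gf_def by (metis mult_divide_mult_cancel_left power_not_zero)
    qed
  qed
  ultimately show ?thesis by (rule Lim_transform_eventually)
qed

lemma powr_of_real_exp:
  assumes "x > 0"
  shows "complex_of_real x powr s = exp (s * of_real (ln x))"
  using assms by (simp add: powr_def Ln_of_real)

lemma node_root_of_unity_free:
  assumes "0 < q" "q < 1" "N > 0" "Re s - real \<nu> + real k \<noteq> 0"
  shows "node q \<nu> k s ^ N \<noteq> 1"
proof
  assume "node q \<nu> k s ^ N = 1"
  hence "norm (node q \<nu> k s) = 1" using assms(3) power_eq_1_iff by blast
  thus False using assms by (simp add: norm_node powr_eq_one_iff_gen)
qed

lemma powr_one_minus_analytic:
  assumes "q < 1"
  shows "(\<lambda>s. complex_of_real (1 - q) powr s) analytic_on A"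
proof -
  have "1 - q > 0" using assms by simp
  from powr_of_real_exp[OF this] show ?thesis by (simp only:) (intro analytic_intros)
qed

lemma powr_one_minus_tendsto:
  assumes "q < 1"
  shows "(\<lambda>s. complex_of_real (1 - q) powr s) \<midarrow>a\<rightarrow> complex_of_real (1 - q) powr a"
  using assms by (intro isContD[OF analytic_at_imp_isCont] powr_one_minus_analytic)

lemma eventually_q_in_unit_interval: "\<forall>\<^sub>F q::real in at_right 0. 0 < q \<and> q < 1"
  using eventually_at_right_real[of 0 1] by simp

lemma powr_one_minus_tendsto_1:
  "((\<lambda>q. complex_of_real (1 - q) powr s) \<longlongrightarrow> 1) (at_right 0)"
proof -
  have "((\<lambda>q. complex_of_real (1 - q) powr s) \<longlongrightarrow> complex_of_real (1 - 0) powr s) (at_right 0)"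
    by (intro tendsto_intros) auto
  thus ?thesis by simp
qed

context
  fixes N :: nat and chi :: "int \<Rightarrow> complex"
  assumes chi: "dirichlet_character N chi"
begin

lemma modulus_pos: "N > 0"
  and chi_periodic: "chi (a + int N) = chi a"
  and chi_one: "chi 1 = 1"
  and chi_modulus: "chi (int N) = (if N = 1 then 1 else 0)"
proof -
  show "N > 0" "chi (a + int N) = chi a"
    using chi by (auto simp: dirichlet_character_def)
  have "chi 1 * chi 1 = chi 1" "chi 1 \<noteq> 0"
    using chi unfolding dirichlet_character_def by (metis mult_1, simp)
  thus one: "chi 1 = 1" by simp
  show "chi (int N) = (if N = 1 then 1 else 0)"
  proof (cases "N = 1")
    case False
    hence "\<not> coprime (int N) (int N)" by simp
    thus ?thesis using chi False unfolding dirichlet_character_def by metis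
  qed (use one in simp)
qed

lemma norm_chi_le: "norm (chi (int n)) \<le> chi_bound N chi"
proof -
  have period: "chi (int (r + j * N)) = chi (int r)" for r j
  proof (induction j)
    case (Suc j)
    have "chi (int (r + Suc j * N)) = chi (int (r + j * N) + int N)"
      by (simp add: algebra_simps)
    thus ?case using Suc chi_periodic by simp
  qed simp
  have "chi (int n) = chi (int (n mod N))"
    using period[of "n mod N" "n div N"] by simp
  moreover have "norm (chi (int (n mod N))) \<le> (\<Sum>r<N. norm (chi (int r)))"
    using modulus_pos by (intro member_le_sum) auto
  ultimately show ?thesis by (simp add: chi_bound_def)
qed

lemma chi_bound_nonneg: "chi_bound N chi \<ge> 0"
  unfolding chi_bound_def by (intro sum_nonneg) auto

text \<open>Periodicity: shifting the index by \<open>N\<close> multiplies the series by \<open>x\<^sup>N\<close>, so the first \<open>N\<close> terms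
  make up the fraction \<open>1 - x\<^sup>N\<close> of the whole.\<close>

lemma char_gf_sums:
  assumes "norm x < 1"
  shows "(\<lambda>n. chi (int (Suc n)) * x ^ Suc n) sums char_gf N chi x"
proof -
  define a where "a n = chi (int (Suc n)) * x ^ Suc n" for n
  have "summable (\<lambda>n. chi_bound N chi * norm x ^ Suc n)"
    using assms by (intro summable_mult) (simp only: summable_Suc_iff, simp add: summable_geometric)
  hence "summable a"
    by (rule summable_comparison_test'[where N = 0])
       (simp only: a_def norm_mult norm_power, intro mult_right_mono norm_chi_le, simp)
  have step: "a (n + N) = x ^ N * a n" for n
  proof -
    have "chi (int (Suc (n + N))) = chi (int (Suc n))"
      using chi_periodic[of "int (Suc n)"] by (simp only: of_nat_add flip: add_Suc)
    thus ?thesis by (simp only: a_def power_add mult_ac flip: add_Suc)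
  qed
  have "suminf a = (\<Sum>n. a (n + N)) + (\<Sum>n<N. a n)"
    by (rule suminf_split_initial_segment) fact
  also have "(\<Sum>n. a (n + N)) = x ^ N * suminf a"
    unfolding step by (rule suminf_mult) fact
  finally have "suminf a - x ^ N * suminf a = (\<Sum>n<N. a n)"
    unfolding diff_eq_eq by (rule trans[OF _ add.commute])
  hence "(1 - x ^ N) * suminf a = (\<Sum>n<N. a n)"
    by (simp only: left_diff_distrib mult_1_left)
  also have "\<dots> = (\<Sum>n=1..N. chi (int n) * x ^ n)"
    by (simp only: a_def One_nat_def sum.atLeast1_atMost_eq)
  finally have eq: "(1 - x ^ N) * suminf a = (\<Sum>n=1..N. chi (int n) * x ^ n)" .
  have "x ^ N \<noteq> 1" using assms modulus_pos by (rule power_ne_1_of_norm_less_1)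
  hence "suminf a = (\<Sum>n=1..N. chi (int n) * x ^ n) / (1 - x ^ N)"
    unfolding eq[symmetric] by simp
  hence "a sums char_gf N chi x"
    using summable_sums[OF \<open>summable a\<close>] by (simp only: char_gf_def)
  thus ?thesis by (simp only: a_def[abs_def])
qed

lemma norm_char_gf_le:
  assumes x: "norm x \<le> \<rho>" "\<rho> < 1"
  shows "norm (char_gf N chi x) \<le> chi_bound N chi / (1 - \<rho>) * norm x"
proof -
  let ?C = "chi_bound N chi"
  have x1: "norm x < 1" using x by linarith
  have geo: "(\<lambda>n. norm x ^ n * (?C * norm x)) sums (1 / (1 - norm x) * (?C * norm x))"
    using x1 by (intro sums_mult2 geometric_sums) simp
  have le: "norm (chi (int (Suc n)) * x ^ Suc n) \<le> norm x ^ n * (?C * norm x)" for n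
  proof -
    have "norm (chi (int (Suc n)) * x ^ Suc n) = norm (chi (int (Suc n))) * norm x ^ Suc n"
      by (simp only: norm_mult norm_power)
    also have "\<dots> \<le> ?C * norm x ^ Suc n"
      by (intro mult_right_mono norm_chi_le) simp
    finally show ?thesis by (simp only: power_Suc mult_ac)
  qed
  have "norm (char_gf N chi x) \<le> (\<Sum>n. norm x ^ n * (?C * norm x))"
    unfolding sums_unique[OF char_gf_sums[OF x1]]
    by (rule norm_suminf_le[OF le sums_summable[OF geo]])
  also have "\<dots> = 1 / (1 - norm x) * (?C * norm x)" using geo by (rule sums_unique[symmetric])
  also have "\<dots> \<le> 1 / (1 - \<rho>) * (?C * norm x)"
    using x chi_bound_nonneg by (intro mult_right_mono divide_left_mono) auto
  finally show ?thesis by (simp only: times_divide_eq_left mult_1_left)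
qed

text \<open>The single estimate behind summability, holomorphy in \<open>s\<close> and the limit \<open>q \<rightarrow> 0\<close> of the tails.
  The quantity \<open>\<delta>\<close> measures how far \<open>s\<close> lies to the right of the line \<open>Re s = \<nu> - M\<close>, and the separate
  \<open>r\<close> allows a summable majorant that does not depend on \<open>q\<close>, with all dependence on \<open>q\<close> collected
  in a factor which vanishes as \<open>q \<rightarrow> 0\<close>.\<close>

lemma norm_L_term_le:
  assumes q: "0 < q" "q \<le> r" "r < 1" and \<delta>: "\<delta> > 0"
    and s: "norm s \<le> R" "Re s \<ge> real \<nu> - real M + \<delta>"
  shows "norm (L_term q \<nu> N chi (k + M) s)
           \<le> chi_bound N chi * q powr \<delta> / (1 - q powr \<delta>) * (rising_binomial (k + M) R * r ^ k)"
proof -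
  have q\<delta>: "q powr \<delta> < 1" using q \<delta> by (subst powr01_less_one) auto
  have "norm (node q \<nu> (k + M) s) \<le> q powr (\<delta> + real k)"
    unfolding norm_node[OF q(1)] using q s by (intro powr_mono') auto
  also have "\<dots> = q powr \<delta> * q ^ k" using q by (simp add: powr_add powr_realpow)
  finally have node: "norm (node q \<nu> (k + M) s) \<le> q powr \<delta> * q ^ k" .
  also have "\<dots> \<le> q powr \<delta>" using q by (simp add: mult_left_le power_le_one)
  finally have "norm (char_gf N chi (node q \<nu> (k + M) s))
                  \<le> chi_bound N chi / (1 - q powr \<delta>) * norm (node q \<nu> (k + M) s)"
    using q\<delta> by (rule norm_char_gf_le)
  also have "\<dots> \<le> chi_bound N chi / (1 - q powr \<delta>) * (q powr \<delta> * r ^ k)"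
  proof (rule mult_left_mono)
    have "q ^ k \<le> r ^ k" using q by (intro power_mono) auto
    hence "q powr \<delta> * q ^ k \<le> q powr \<delta> * r ^ k" by (intro mult_left_mono) auto
    with node show "norm (node q \<nu> (k + M) s) \<le> q powr \<delta> * r ^ k" by linarith
  qed (use chi_bound_nonneg q\<delta> in auto)
  finally have "norm (L_term q \<nu> N chi (k + M) s)
      \<le> rising_binomial (k + M) R * (chi_bound N chi / (1 - q powr \<delta>) * (q powr \<delta> * r ^ k))"
    unfolding L_term_def norm_mult
    using norm_rising_binomial_le[OF s(1), of "k + M"]
    by (intro mult_mono) (auto intro: order_trans[OF norm_ge_zero])
  thus ?thesis by (simp add: mult_ac)
qed

lemma summable_L_term:
  assumes q: "0 < q" "q < 1"
  shows "summable (\<lambda>k. L_term q \<nu> N chi k s)"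
proof -
  obtain M :: nat where M: "real \<nu> - Re s < real M" using reals_Archimedean2 by blast
  have "summable (\<lambda>k. L_term q \<nu> N chi (k + M) s)"
  proof (rule summable_comparison_test')
    show "norm (L_term q \<nu> N chi (k + M) s)
            \<le> chi_bound N chi * q powr (Re s - real \<nu> + real M) / (1 - q powr (Re s - real \<nu> + real M))
               * (rising_binomial (k + M) (norm s) * q ^ k)" for k
      by (rule norm_L_term_le) (use q M in auto)
  qed (use q in \<open>intro summable_mult summable_rising_binomial_real, auto\<close>)
  thus ?thesis by (rule iffD1[OF summable_iff_shift])
qed

lemma L_expansion_split:
  assumes q: "0 < q" "q < 1"
  shows "L_expansion q \<nu> N chi s =
    of_real (1 - q) powr s * ((\<Sum>k<M. L_term q \<nu> N chi k s) + L_tail q \<nu> N chi M s)"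
  unfolding L_expansion_def L_tail_def
  using suminf_split_initial_segment[OF summable_L_term[OF q], of \<nu> s M] by simp

lemma L_tail_holomorphic:
  assumes q: "0 < q" "q < 1"
  shows "L_tail q \<nu> N chi M holomorphic_on {s. Re s > real \<nu> - real M}"
proof (rule holomorphic_uniform_sequence)
  show "open {s. Re s > real \<nu> - real M}" by (rule open_halfspace_Re_gt)
  show "(\<lambda>s. \<Sum>k<n. L_term q \<nu> N chi (k + M) s) holomorphic_on {s. Re s > real \<nu> - real M}" for n
  proof (intro holomorphic_on_sum analytic_imp_holomorphic L_term_analytic q)
    fix k s assume "s \<in> {s. Re s > real \<nu> - real M}"
    hence "q powr (Re s - real \<nu> + real (k + M)) < 1" using q by (subst powr01_less_one) auto
    thus "node q \<nu> (k + M) s ^ N \<noteq> 1"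
      using modulus_pos by (intro power_ne_1_of_norm_less_1) (simp_all add: norm_node[OF q(1)])
  qed
next
  fix z assume z: "z \<in> {s. Re s > real \<nu> - real M}"
  define \<delta> where "\<delta> = (Re z - (real \<nu> - real M)) / 2"
  have \<delta>: "\<delta> > 0" using z by (simp add: \<delta>_def)
  have bounds: "Re s \<ge> real \<nu> - real M + \<delta>" "norm s \<le> norm z + \<delta>" if "s \<in> cball z \<delta>" for s
  proof -
    have d: "norm (z - s) \<le> \<delta>" using that by (simp add: dist_norm)
    show "Re s \<ge> real \<nu> - real M + \<delta>"
      using d abs_Re_le_cmod[of "z - s"] by (simp add: \<delta>_def field_simps)
    show "norm s \<le> norm z + \<delta>"
      using d norm_triangle_ineq2[of s z] by (simp add: norm_minus_commute)
  qed
  have "uniform_limit (cball z \<delta>) (\<lambda>n s. \<Sum>k<n. L_term q \<nu> N chi (k + M) s)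
          (L_tail q \<nu> N chi M) sequentially"
    unfolding L_tail_def[abs_def]
  proof (rule Weierstrass_m_test)
    show "norm (L_term q \<nu> N chi (k + M) s)
            \<le> chi_bound N chi * q powr \<delta> / (1 - q powr \<delta>)
               * (rising_binomial (k + M) (norm z + \<delta>) * q ^ k)" if "s \<in> cball z \<delta>" for k s
      by (rule norm_L_term_le) (use q \<delta> bounds[OF that] in auto)
  qed (use q in \<open>intro summable_mult summable_rising_binomial_real, auto\<close>)
  moreover have "cball z \<delta> \<subseteq> {s. Re s > real \<nu> - real M}"
    using bounds(1) \<delta> by force
  ultimately show "\<exists>d>0. cball z d \<subseteq> {s. Re s > real \<nu> - real M} \<and>
      uniform_limit (cball z d) (\<lambda>n s. \<Sum>k<n. L_term q \<nu> N chi (k + M) s) (L_tail q \<nu> N chi M) sequentially"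
    using \<delta> by blast
qed

lemma L_tail_analytic:
  assumes "0 < q" "q < 1" "Re s > real \<nu> - real M"
  shows "L_tail q \<nu> N chi M analytic_on {s}"
  using L_tail_holomorphic[OF assms(1,2), of \<nu> M] assms(3)
  by (auto simp: analytic_at intro!: exI[of _ "{s. Re s > real \<nu> - real M}"] open_halfspace_Re_gt)

text \<open>With \<open>\<delta> = Re s - \<nu> + M > 0\<close> the tail is of order \<open>q\<^sup>\<delta>\<close>.\<close>

lemma L_tail_tendsto_0:
  assumes "Re s > real \<nu> - real M"
  shows "((\<lambda>q. L_tail q \<nu> N chi M s) \<longlongrightarrow> 0) (at_right 0)"
proof -
  define \<delta> where "\<delta> = Re s - real \<nu> + real M"
  define S where "S = (\<Sum>k. rising_binomial (k + M) (norm s) * (1 / 2) ^ k)"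
  have \<delta>: "\<delta> > 0" using assms by (simp add: \<delta>_def)
  have "((\<lambda>q. (chi_bound N chi * q powr \<delta> / (1 - q powr \<delta>)) * S) \<longlongrightarrow> (chi_bound N chi * 0 / (1 - 0)) * S) (at_right 0)"
  proof (intro tendsto_intros)
    have "((\<lambda>q. q powr \<delta>) \<longlongrightarrow> 0 powr \<delta>) (at_right (0::real))"
      using \<delta> by (intro tendsto_powr') (auto simp: eventually_at_filter)
    thus "((\<lambda>q. q powr \<delta>) \<longlongrightarrow> 0) (at_right (0::real))" using \<delta> by simp
    thus "((\<lambda>q. q powr \<delta>) \<longlongrightarrow> 0) (at_right (0::real))" .
  qed auto
  hence lim: "((\<lambda>q. (chi_bound N chi * q powr \<delta> / (1 - q powr \<delta>)) * S) \<longlongrightarrow> 0) (at_right 0)" by simp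
  have summ: "summable (\<lambda>k. rising_binomial (k + M) (norm s) * (1/2) ^ k)"
    by (rule summable_rising_binomial_real) simp
  have "\<forall>\<^sub>F q in at_right 0. norm (L_tail q \<nu> N chi M s) \<le> (chi_bound N chi * q powr \<delta> / (1 - q powr \<delta>)) * S"
    using eventually_at_right_real[of 0 "1/2 :: real", OF half_gt_zero[OF zero_less_one]]
  proof eventually_elim
    case (elim q)
    have "norm (L_term q \<nu> N chi (k + M) s)
        \<le> chi_bound N chi * q powr \<delta> / (1 - q powr \<delta>)
           * (rising_binomial (k + M) (norm s) * (1/2) ^ k)" for k
      by (rule norm_L_term_le) (use elim \<delta> in \<open>auto simp: \<delta>_def\<close>)
    hence "norm (L_tail q \<nu> N chi M s)
        \<le> (\<Sum>k. (chi_bound N chi * q powr \<delta> / (1 - q powr \<delta>)) * (rising_binomial (k + M) (norm s) * (1/2) ^ k))"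
      unfolding L_tail_def by (intro norm_suminf_le summable_mult summ) auto
    also have "\<dots> = (chi_bound N chi * q powr \<delta> / (1 - q powr \<delta>)) * S"
      unfolding S_def by (rule suminf_mult[OF summ])
    finally show ?case .
  qed
  from this lim show ?thesis by (rule Lim_null_comparison)
qed

section \<open>Meromorphic continuation\<close>

text \<open>With \<open>u = q\<^bsup>s-\<nu>\<^esup>\<close>, \<open>|u| < 1\<close>, both sides are iterated sums of
  \<open>(1-q)\<^sup>s \<chi>(n) u\<^sup>n ((s)\<^sub>k / k!) q\<^bsup>nk\<^esup>\<close>: summing over \<open>k\<close> first is the binomial series, summing over \<open>n\<close>
  first is the generating function at \<open>u q\<^sup>k\<close>. The bound \<open>q\<^bsup>nk\<^esup> \<le> q\<^sup>k\<close> separates the variables.\<close>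

lemma q_L_series_eq_L_expansion:
  assumes q: "0 < q" "q < 1" and s: "Re s > real \<nu>"
  shows "q_L_series q \<nu> chi s = L_expansion q \<nu> N chi s"
proof -
  define u where "u = complex_of_real q powr (s - of_nat \<nu>)"
  define F where "F n k = of_real (1 - q) powr s *
      (chi (int (Suc n)) * u ^ Suc n * (rising_binomial k s * (of_real q ^ Suc n) ^ k))" for n k
  have u: "norm u < 1"
    unfolding u_def using q s by (simp add: norm_powr_real_powr powr01_less_one)
  have uq: "norm (u * of_real q ^ k) < 1" for k
    using u q mult_mono[of "norm u" "norm u" "q ^ k" 1] by (simp add: norm_mult norm_power power_le_one)

  \<comment> \<open>Summation over \<open>k\<close> gives the terms of the defining series.\<close>
  have row: "F n sums (let m = Suc n in chi (int m) * of_real q powr (of_nat m * (s - of_nat \<nu>))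
                  / of_real (q_number q m) powr s)" for n
  proof -
    have qn: "0 < q ^ Suc n" "q ^ Suc n < 1" using q power_Suc_less_one[of q n] by auto
    have "norm (complex_of_real q ^ Suc n) < 1" using qn q by (simp add: norm_power norm_mult)
    from rising_binomial_sums[OF this, of s]
    have "F n sums (of_real (1 - q) powr s *
            (chi (int (Suc n)) * u ^ Suc n * (1 - of_real q ^ Suc n) powr (- s)))"
      unfolding F_def by (intro sums_mult)
    also have "u ^ Suc n = of_real q powr (of_nat (Suc n) * (s - of_nat \<nu>))"
      unfolding u_def powr_of_real_exp[OF q(1)] exp_of_nat_mult[symmetric] by (simp only: mult.assoc)
    also have "(1 - complex_of_real q ^ Suc n) powr (- s) = inverse (of_real (1 - q ^ Suc n) powr s)"
      by (simp add: powr_minus)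
    also have "of_real (1 - q) powr s * (chi (int (Suc n)) * of_real q powr (of_nat (Suc n) * (s - of_nat \<nu>))
                 * inverse (of_real (1 - q ^ Suc n) powr s))
             = chi (int (Suc n)) * of_real q powr (of_nat (Suc n) * (s - of_nat \<nu>))
                 / (of_real (1 - q ^ Suc n) powr s / of_real (1 - q) powr s)"
      by (simp only: divide_inverse inverse_mult_distrib inverse_inverse_eq mult_ac)
    also have "of_real (1 - q ^ Suc n) powr s / of_real (1 - q) powr s
             = complex_of_real (q_number q (Suc n)) powr s"
    proof -
      have pos: "1 - q ^ Suc n > 0" "1 - q > 0" "q_number q (Suc n) > 0"
        using q qn by (auto simp: q_number_def simp del: power_Suc)
      have "ln (q_number q (Suc n)) = ln (1 - q ^ Suc n) - ln (1 - q)"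
        unfolding q_number_def by (rule ln_divide_pos) (use pos in auto)
      thus ?thesis
        unfolding powr_of_real_exp[OF pos(1)] powr_of_real_exp[OF pos(2)] powr_of_real_exp[OF pos(3)]
        by (simp add: exp_diff ring_distribs)
    qed
    finally show ?thesis by (simp only: Let_def)
  qed

  \<comment> \<open>Summation over \<open>n\<close> gives the terms of the expansion.\<close>
  have col: "(\<lambda>n. F n k) sums (of_real (1 - q) powr s * L_term q \<nu> N chi k s)" for k
  proof -
    have "(\<lambda>n. of_real (1 - q) powr s * (rising_binomial k s *
              (chi (int (Suc n)) * (u * of_real q ^ k) ^ Suc n)))
            sums (of_real (1 - q) powr s * (rising_binomial k s * char_gf N chi (u * of_real q ^ k)))"
      by (intro sums_mult char_gf_sums uq)
    moreover have "(complex_of_real q ^ Suc n) ^ k = (of_real q ^ k) ^ Suc n" for n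
      by (simp only: power_mult[symmetric] mult.commute)
    hence "of_real (1 - q) powr s * (rising_binomial k s *
              (chi (int (Suc n)) * (u * of_real q ^ k) ^ Suc n)) = F n k" for n
      by (simp only: F_def power_mult_distrib mult_ac)
    ultimately show ?thesis
      by (simp only: L_term_def node_eq_geometric[OF q(1)] u_def)
  qed

  define A where "A n = norm (complex_of_real (1 - q) powr s) * chi_bound N chi * norm u ^ Suc n" for n
  define B where "B k = rising_binomial k (norm s) * q ^ k" for k
  have B_nonneg: "rising_binomial k (norm s) \<ge> 0" for k
    using norm_rising_binomial_le[of s "norm s" k] norm_ge_zero order_trans by blast
  have "norm (F n k) \<le> A n * B k" for n k
  proof -
    have "norm (F n k) = (norm (complex_of_real (1 - q) powr s) * norm (chi (int (Suc n))) * norm u ^ Suc n)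
            * (norm (rising_binomial k s) * (q ^ Suc n) ^ k)"
      using q by (simp add: F_def norm_mult norm_power mult_ac del: power_Suc of_nat_Suc)
    also have "\<dots> \<le> A n * B k"
      unfolding A_def B_def
    proof (intro mult_mono norm_rising_binomial_le)
      have "q ^ Suc n \<le> q" using q power_le_one[of q n] mult_left_mono[of "q ^ n" 1 q] by simp
      thus "(q ^ Suc n) ^ k \<le> q ^ k" using q by (intro power_mono) auto
    qed (use q B_nonneg norm_chi_le[of "Suc n"] chi_bound_nonneg
         in \<open>auto intro!: mult_nonneg_nonneg simp del: of_nat_Suc\<close>)
    finally show ?thesis .
  qed
  moreover have "summable A"
    unfolding A_def using u by (intro summable_mult) (simp only: summable_Suc_iff, simp add: summable_geometric)
  moreover have "summable B"
    using summable_rising_binomial_real[of q 0 "norm s"] q by (simp add: B_def[abs_def])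
  moreover have "A n \<ge> 0" "B n \<ge> 0" for n
    using B_nonneg q chi_bound_nonneg by (auto simp: A_def B_def)
  ultimately have "(\<Sum>n. \<Sum>k. F n k) = (\<Sum>k. \<Sum>n. F n k)"
    by (intro suminf_swap_of_product_bound[where A = A and B = B])
  also have "(\<Sum>n. \<Sum>k. F n k) = q_L_series q \<nu> chi s"
    unfolding q_L_series_def by (intro suminf_cong sums_unique[symmetric] row)
  also have "(\<Sum>k. \<Sum>n. F n k) = (\<Sum>k. of_real (1 - q) powr s * L_term q \<nu> N chi k s)"
    by (intro suminf_cong sums_unique[symmetric] col)
  also have "\<dots> = L_expansion q \<nu> N chi s"
    unfolding L_expansion_def L_tail_def
    using suminf_mult[OF summable_L_term[OF q]] by simp
  finally show ?thesis .
qed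

text \<open>Near a given point, all but finitely many terms form a holomorphic tail.\<close>

lemma L_expansion_meromorphic:
  assumes q: "0 < q" "q < 1"
  shows "L_expansion q \<nu> N chi meromorphic_on UNIV"
  unfolding meromorphic_on_meromorphic_at[of _ UNIV]
proof
  fix z :: complex
  obtain M :: nat where "real \<nu> - Re z < real M" using reals_Archimedean2 by blast
  hence M: "L_tail q \<nu> N chi M meromorphic_on {z}"
    using q by (intro analytic_on_imp_meromorphic_on L_tail_analytic) auto
  have "(\<lambda>s. complex_of_real (1 - q) powr s) meromorphic_on {z}"
    using q by (intro analytic_on_imp_meromorphic_on powr_one_minus_analytic) auto
  with M have "(\<lambda>s. of_real (1 - q) powr s * ((\<Sum>k<M. L_term q \<nu> N chi k s) + L_tail q \<nu> N chi M s))
          meromorphic_on {z}"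
    using q by (intro meromorphic_intros L_term_meromorphic)
  thus "L_expansion q \<nu> N chi meromorphic_on {z}"
    by (simp only: L_expansion_split[OF q, symmetric])
qed

lemma L_expansion_analytic:
  assumes q: "0 < q" "q < 1" and s: "\<And>k. real k \<le> real \<nu> - Re s \<Longrightarrow> node q \<nu> k s ^ N \<noteq> 1"
  shows "L_expansion q \<nu> N chi analytic_on {s}"
proof -
  obtain M :: nat where M: "real \<nu> - Re s < real M" using reals_Archimedean2 by blast
  have node: "node q \<nu> k s ^ N \<noteq> 1" for k
  proof (cases "real k \<le> real \<nu> - Re s")
    case False
    thus ?thesis using q modulus_pos by (intro node_root_of_unity_free) auto
  qed (rule s)
  have "(\<lambda>s. of_real (1 - q) powr s * ((\<Sum>k<M. L_term q \<nu> N chi k s) + L_tail q \<nu> N chi M s))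
          analytic_on {s}"
    using q M node
    by (intro analytic_on_mult analytic_on_add analytic_on_sum powr_one_minus_analytic
              L_term_analytic L_tail_analytic) auto
  thus ?thesis by (simp only: L_expansion_split[OF q, symmetric])
qed

text \<open>The expansion agrees with the series on a half-plane and is meromorphic everywhere, so the
  identity theorem makes it the continuation once its singularities are normalised.\<close>

lemma q_L_eq_remove_sings:
  assumes q: "0 < q" "q < 1"
  shows "q_L q \<nu> chi = remove_sings (L_expansion q \<nu> N chi)"
  unfolding q_L_def
proof (rule the_equality)
  have series: "remove_sings (L_expansion q \<nu> N chi) s = q_L_series q \<nu> chi s" if "Re s > real \<nu>" for s
    using that q by (simp add: L_expansion_analytic q_L_series_eq_L_expansion)
  show nice: "remove_sings (L_expansion q \<nu> N chi) nicely_meromorphic_on UNIV \<and>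
      (\<forall>s. Re s > real \<nu> \<longrightarrow> remove_sings (L_expansion q \<nu> N chi) s = q_L_series q \<nu> chi s)"
    using series q by (auto intro: remove_sings_nicely_meromorphic L_expansion_meromorphic)
  fix f assume f: "f nicely_meromorphic_on UNIV \<and> (\<forall>s. Re s > real \<nu> \<longrightarrow> f s = q_L_series q \<nu> chi s)"
  have "\<forall>\<^sub>F s in at (of_nat \<nu> + 1). s \<in> {s. Re s > real \<nu>}"
    by (intro eventually_at_in_open' open_halfspace_Re_gt) auto
  hence "\<forall>\<^sub>F s in at (of_nat \<nu> + 1). f s = remove_sings (L_expansion q \<nu> N chi) s"
    by eventually_elim (use f series in auto)
  hence "\<exists>\<^sub>F s in at (of_nat \<nu> + 1). f s = remove_sings (L_expansion q \<nu> N chi) s"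
    by (intro eventually_frequently) auto
  with f nice show "f = remove_sings (L_expansion q \<nu> N chi)"
    by (intro nicely_meromorphic_eqI) auto
qed

lemma is_pole_q_L_iff:
  assumes "0 < q" "q < 1"
  shows "is_pole (q_L q \<nu> chi) s \<longleftrightarrow> is_pole (L_expansion q \<nu> N chi) s"
proof -
  have "isolated_singularity_at (L_expansion q \<nu> N chi) s"
    using L_expansion_meromorphic[OF assms] by (metis UNIV_I meromorphic_onE)
  thus ?thesis using assms by (simp add: q_L_eq_remove_sings)
qed

text \<open>A finite limit of the expansion at \<open>s\<close> both gives the value of the continuation and excludes a
  pole. This covers the removable singularities, where the value of the expansion itself is
  meaningless because one of its terms divides by zero.\<close>

lemma q_L_eq_limit:
  assumes q: "0 < q" "q < 1" and l: "L_expansion q \<nu> N chi \<midarrow>s\<rightarrow> l"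
  shows "q_L q \<nu> chi s = l" and "\<not> is_pole (q_L q \<nu> chi) s"
proof -
  show "q_L q \<nu> chi s = l" using q l by (simp add: q_L_eq_remove_sings remove_sings_eqI)
  have "\<not> is_pole (L_expansion q \<nu> N chi) s"
    using l unfolding is_pole_def by (meson at_neq_bot not_tendsto_and_filterlim_at_infinity)
  thus "\<not> is_pole (q_L q \<nu> chi) s" using q by (simp add: is_pole_q_L_iff)
qed

lemma q_L_eq_L_expansion:
  assumes q: "0 < q" "q < 1" and s: "\<And>k. real k \<le> real \<nu> - Re s \<Longrightarrow> node q \<nu> k s ^ N \<noteq> 1"
  shows "q_L q \<nu> chi s = L_expansion q \<nu> N chi s" and "\<not> is_pole (q_L q \<nu> chi) s"
  using q_L_eq_limit[OF q isContD[OF analytic_at_imp_isCont[OF L_expansion_analytic[OF assms]]]]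
  by auto

section \<open>Crystal limits\<close>

text \<open>The expansion without its \<open>K\<close>-th term, and without the factor \<open>(1-q)\<^sup>s\<close>. On the line
  \<open>Re s = \<nu> - K\<close> only the omitted term can be singular.\<close>

definition L_rest :: "real \<Rightarrow> nat \<Rightarrow> nat \<Rightarrow> complex \<Rightarrow> complex" where
  "L_rest q \<nu> K s = (\<Sum>k<K. L_term q \<nu> N chi k s) + L_tail q \<nu> N chi (Suc K) s"

lemma L_expansion_isolate:
  assumes "0 < q" "q < 1"
  shows "L_expansion q \<nu> N chi s =
           of_real (1 - q) powr s * (L_rest q \<nu> K s + L_term q \<nu> N chi K s)"
  unfolding L_expansion_split[OF assms, of \<nu> s "Suc K"] L_rest_def by (simp add: algebra_simps)

lemma L_rest_analytic:
  assumes "0 < q" "q < 1" "Re s = real \<nu> - real K"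
  shows "L_rest q \<nu> K analytic_on {s}"
proof -
  have "(\<lambda>s. L_rest q \<nu> K s) analytic_on {s}"
    unfolding L_rest_def using assms modulus_pos
    by (intro analytic_intros L_term_analytic L_tail_analytic node_root_of_unity_free) auto
  thus ?thesis by simp
qed

lemma L_term_tendsto:
  assumes "Re s - real \<nu> + real k < 0"
  shows "((\<lambda>q. L_term q \<nu> N chi k s) \<longlongrightarrow> rising_binomial k s * - chi (int N)) (at_right 0)"
  unfolding L_term_def
proof (intro tendsto_mult tendsto_const)
  have "filterlim (\<lambda>q. norm (node q \<nu> k s)) at_top (at_right 0)"
  proof (rule filterlim_cong[THEN iffD1, OF refl refl])
    show "\<forall>\<^sub>F q in at_right 0. q powr (Re s - real \<nu> + real k) = norm (node q \<nu> k s)"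
      using eventually_at_right_less[of 0] by eventually_elim (simp add: norm_node)
    show "filterlim (\<lambda>q::real. q powr (Re s - real \<nu> + real k)) at_top (at_right 0)"
      using assms by real_asymp
  qed
  hence "filterlim (\<lambda>q. node q \<nu> k s) at_infinity (at_right 0)"
    by (rule filterlim_norm_at_top_imp_at_infinity)
  thus "((\<lambda>q. char_gf N chi (node q \<nu> k s)) \<longlongrightarrow> - chi (int N)) (at_right 0)"
    by (rule filterlim_compose[OF char_gf_tendsto_at_infinity[OF modulus_pos]])
qed

lemma sum_L_term_tendsto:
  assumes "Re s - real \<nu> + real K < 1"
  shows "((\<lambda>q. \<Sum>k<K. L_term q \<nu> N chi k s)
           \<longlongrightarrow> - chi (int N) * (\<Sum>k<K. rising_binomial k s)) (at_right 0)"
proof -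
  have "((\<lambda>q. \<Sum>k<K. L_term q \<nu> N chi k s)
           \<longlongrightarrow> (\<Sum>k<K. rising_binomial k s * - chi (int N))) (at_right 0)"
    using assms by (intro tendsto_sum L_term_tendsto) auto
  thus ?thesis by (simp only: sum_distrib_left mult.commute)
qed

lemma L_rest_tendsto:
  assumes "Re s = real \<nu> - real K"
  shows "((\<lambda>q. L_rest q \<nu> K s) \<longlongrightarrow> - chi (int N) * (\<Sum>k<K. rising_binomial k s)) (at_right 0)"
proof -
  have "((\<lambda>q. L_rest q \<nu> K s)
          \<longlongrightarrow> - chi (int N) * (\<Sum>k<K. rising_binomial k s) + 0) (at_right 0)"
    unfolding L_rest_def using assms
    by (intro tendsto_add sum_L_term_tendsto L_tail_tendsto_0) auto
  thus ?thesis by simp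
qed

text \<open>The number \<open>M\<close> counts the terms whose argument \<open>q\<^bsup>s-\<nu>+k\<^esup>\<close> tends to infinity. Each of them contributes
  \<open>-\<chi>(N)\<close> times its coefficient; all later terms tend to \<open>0\<close>.\<close>

lemma crystal_limit_open_strip:
  assumes "real \<nu> - real M < Re s" "M > 0 \<Longrightarrow> Re s < real \<nu> - real M + 1"
  shows "L_0_is \<nu> chi s (- chi (int N) * (\<Sum>k<M. rising_binomial k s))"
proof -
  have reg: "node q \<nu> k s ^ N \<noteq> 1" if "0 < q" "q < 1" "real k \<le> real \<nu> - Re s" for q k
  proof (intro node_root_of_unity_free that modulus_pos)
    have "real k < real M" using that assms(1) by linarith
    hence "Suc k \<le> M" by simp
    hence "real k \<le> real M - 1" "M > 0" by auto
    thus "Re s - real \<nu> + real k \<noteq> 0" using assms(2) by linarith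
  qed
  have sum: "((\<lambda>q. \<Sum>k<M. L_term q \<nu> N chi k s)
           \<longlongrightarrow> - chi (int N) * (\<Sum>k<M. rising_binomial k s)) (at_right 0)"
    using assms(2) by (cases "M = 0") (simp, intro sum_L_term_tendsto, simp)
  have "((\<lambda>q. of_real (1 - q) powr s * ((\<Sum>k<M. L_term q \<nu> N chi k s) + L_tail q \<nu> N chi M s))
          \<longlongrightarrow> 1 * (- chi (int N) * (\<Sum>k<M. rising_binomial k s) + 0)) (at_right 0)"
    by (intro tendsto_mult tendsto_add powr_one_minus_tendsto_1 sum L_tail_tendsto_0 assms)
  moreover have "\<forall>\<^sub>F q in at_right 0. of_real (1 - q) powr s * ((\<Sum>k<M. L_term q \<nu> N chi k s) + L_tail q \<nu> N chi M s)
          = q_L q \<nu> chi s"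
    using eventually_q_in_unit_interval
    by eventually_elim (simp add: q_L_eq_L_expansion reg L_expansion_split[of _ _ s M])
  ultimately have "((\<lambda>q. q_L q \<nu> chi s)
      \<longlongrightarrow> - chi (int N) * (\<Sum>k<M. rising_binomial k s)) (at_right 0)"
    using Lim_transform_eventually by fastforce
  moreover have "\<forall>\<^sub>F q in at_right 0. \<not> is_pole (q_L q \<nu> chi) s"
    using eventually_q_in_unit_interval by eventually_elim (simp add: q_L_eq_L_expansion reg)
  ultimately show ?thesis by (simp add: L_0_is_def has_crystal_limit_def)
qed

text \<open>The singularity at \<open>q\<^bsup>s-\<nu>+K\<^esup> = 1\<close>: the denominator \<open>1 - q\<^bsup>N(z-a)\<^esup>\<close> has a simple zero at \<open>a = \<nu> - K\<close>
  with derivative \<open>-N log q\<close>. The residue decays like \<open>1 / log q\<close> as \<open>q \<rightarrow> 0\<close>, which is why this term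
  leaves no trace in the limits at the non-positive integers.\<close>

lemma char_gf_node_residue:
  assumes q: "0 < q" "q < 1" and a: "a = of_nat \<nu> - of_nat K"
  shows "(\<lambda>z. (z - a) * char_gf N chi (node q \<nu> K z))
           \<midarrow>a\<rightarrow> (\<Sum>n=1..N. chi (int n)) / of_nat N * of_real (inverse (- ln q))"
proof -
  define P where "P x = (\<Sum>n=1..N. chi (int n) * x ^ n)" for x
  define h where "h z = 1 - node q \<nu> K z ^ N" for z
  have node: "node q \<nu> K z = exp ((z - a) * of_real (ln q))" for z
    using q by (simp add: node_def powr_of_real_exp a algebra_simps)
  have h_a: "h a = 0" and node_a: "node q \<nu> K a = 1" by (auto simp: h_def node)
  have "(h has_field_derivative - (of_nat N * of_real (ln q))) (at a)"
    unfolding h_def[abs_def] node by (auto intro!: derivative_eq_intros)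
  hence "(\<lambda>z. h z / (z - a)) \<midarrow>a\<rightarrow> - (of_nat N * of_real (ln q))"
    by (simp add: has_field_derivative_iff h_a)
  moreover have "(\<lambda>z. P (node q \<nu> K z)) \<midarrow>a\<rightarrow> P (node q \<nu> K a)"
    unfolding P_def node by (intro tendsto_intros)
  ultimately have "(\<lambda>z. P (node q \<nu> K z) / (h z / (z - a)))
        \<midarrow>a\<rightarrow> P (node q \<nu> K a) / - (of_nat N * of_real (ln q))"
    using q modulus_pos by (intro tendsto_divide) auto
  moreover have "P (node q \<nu> K a) / - (of_nat N * of_real (ln q))
                   = (\<Sum>n=1..N. chi (int n)) / of_nat N * of_real (inverse (- ln q))"
    by (simp add: P_def node_a divide_inverse)
  ultimately show ?thesis by (simp only:) (simp add: P_def h_def char_gf_def mult.commute)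
qed

text \<open>For \<open>K = \<nu> + m\<close> the coefficient \<open>(s)\<^sub>K / K!\<close> vanishes at \<open>-m\<close>, so its product with the simple pole
  of the \<open>K\<close>-th term tends to a derivative times a residue, a constant
  multiple of \<open>1 / log q\<close>. The remaining
  coefficients sum up to \<open>(1-m)\<^sub>l / l!\<close> with \<open>l = K - 1 \<ge> m\<close>, which is \<open>0\<close> unless \<open>m = 0\<close>.\<close>

lemma crystal_limit_nonpos_int:
  assumes "\<nu> > 0"
  shows "L_0_is \<nu> chi (- of_nat m) (- chi (int N) * (if m = 0 then 1 else 0))"
proof -
  define K where "K = \<nu> + m"
  define a :: complex where "a = - of_nat m"
  define D where "D = deriv (rising_binomial K) a"
  define V where "V q = complex_of_real (1 - q) powr a * (L_rest q \<nu> K a +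
      D * ((\<Sum>n=1..N. chi (int n)) / of_nat N * of_real (inverse (- ln q))))" for q
  have a: "a = of_nat \<nu> - of_nat K" "Re a = real \<nu> - real K" by (auto simp: a_def K_def)
  have zero: "rising_binomial K a = 0"
    using assms by (simp add: rising_binomial_def a_def K_def pochhammer_of_nat_eq_0_iff)
  have "(rising_binomial K has_field_derivative D) (at a)"
    unfolding D_def by (intro analytic_derivI rising_binomial_analytic)
  hence D: "(\<lambda>z. rising_binomial K z / (z - a)) \<midarrow>a\<rightarrow> D"
    by (simp add: has_field_derivative_iff zero)
  have lim: "L_expansion q \<nu> N chi \<midarrow>a\<rightarrow> V q" if q: "0 < q" "q < 1" for q
  proof -
    have "L_rest q \<nu> K \<midarrow>a\<rightarrow> L_rest q \<nu> K a"
      by (rule isContD[OF analytic_at_imp_isCont[OF L_rest_analytic[OF q a(2)]]])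
    moreover have "(\<lambda>z. complex_of_real (1 - q) powr z) \<midarrow>a\<rightarrow> complex_of_real (1 - q) powr a"
      using q by (intro powr_one_minus_tendsto)
    ultimately have "(\<lambda>z. complex_of_real (1 - q) powr z * (L_rest q \<nu> K z +
        rising_binomial K z / (z - a) * ((z - a) * char_gf N chi (node q \<nu> K z)))) \<midarrow>a\<rightarrow> V q"
      unfolding V_def by (intro tendsto_mult tendsto_add D char_gf_node_residue q a)
    moreover have "\<forall>\<^sub>F z in at a. complex_of_real (1 - q) powr z * (L_rest q \<nu> K z +
        rising_binomial K z / (z - a) * ((z - a) * char_gf N chi (node q \<nu> K z))) = L_expansion q \<nu> N chi z"
      using eventually_neq_at_within[of a a UNIV]
      by eventually_elim (simp add: L_expansion_isolate[OF q, of _ _ K] L_term_def)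
    ultimately show ?thesis by (rule Lim_transform_eventually)
  qed
  have "filterlim (\<lambda>q. - ln q) at_top (at_right (0::real))"
    by (simp add: filterlim_uminus_at_top ln_at_0)
  hence "((\<lambda>q. inverse (- ln q)) \<longlongrightarrow> 0) (at_right (0::real))" by (rule tendsto_inverse_0_at_top)
  hence D_lim: "((\<lambda>q. D * ((\<Sum>n=1..N. chi (int n)) / of_nat N * of_real (inverse (- ln q))))
          \<longlongrightarrow> D * ((\<Sum>n=1..N. chi (int n)) / of_nat N * of_real 0)) (at_right 0)"
    by (intro tendsto_intros)
  have "((\<lambda>q. complex_of_real (1 - q) powr a * (L_rest q \<nu> K a
            + D * ((\<Sum>n=1..N. chi (int n)) / of_nat N * of_real (inverse (- ln q)))))
          \<longlongrightarrow> 1 * (- chi (int N) * (\<Sum>k<K. rising_binomial k a)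
               + D * ((\<Sum>n=1..N. chi (int n)) / of_nat N * of_real 0))) (at_right 0)"
    by (intro tendsto_mult[OF powr_one_minus_tendsto_1 tendsto_add[OF L_rest_tendsto[OF a(2)] D_lim]])
  hence V: "(V \<longlongrightarrow> - chi (int N) * (\<Sum>k<K. rising_binomial k a)) (at_right 0)"
    by (simp only: V_def[abs_def] of_real_0 mult_zero_right add_0_right mult_1_left)
  have "(\<Sum>k<K. rising_binomial k a) = rising_binomial (K - 1) (a + 1)"
    using assms sum_rising_binomial[where n = "K - 1" and s = a]
    by (simp add: K_def lessThan_Suc_atMost[symmetric])
  also have "\<dots> = (if m = 0 then 1 else 0)"
  proof (cases m)
    case (Suc m')
    hence "a + 1 = - of_nat m'" by (simp add: a_def)
    thus ?thesis using Suc assms by (simp add: rising_binomial_def pochhammer_of_nat_eq_0_iff K_def)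
  qed (simp add: a_def rising_binomial_def flip: pochhammer_fact)
  finally have V': "(V \<longlongrightarrow> - chi (int N) * (if m = 0 then 1 else 0)) (at_right 0)" using V by simp
  have "\<forall>\<^sub>F q in at_right 0. V q = q_L q \<nu> chi a"
    using eventually_q_in_unit_interval by eventually_elim (simp add: q_L_eq_limit(1)[OF _ _ lim])
  with V' have "((\<lambda>q. q_L q \<nu> chi a) \<longlongrightarrow> - chi (int N) * (if m = 0 then 1 else 0)) (at_right 0)"
    by (rule Lim_transform_eventually)
  moreover have "\<forall>\<^sub>F q in at_right 0. \<not> is_pole (q_L q \<nu> chi) a"
    using eventually_q_in_unit_interval by eventually_elim (simp add: q_L_eq_limit(2)[OF _ _ lim])
  ultimately show ?thesis by (simp add: L_0_is_def has_crystal_limit_def a_def)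
qed

section \<open>Points without a crystal limit\<close>

text \<open>At the positive integer \<open>\<nu> - K\<close> the coefficient \<open>(s)\<^sub>K / K!\<close> is non-zero, so it cannot cancel the
  pole of the \<open>K\<close>-th term.\<close>

lemma is_pole_q_L:
  assumes q: "0 < q" "q < 1" and K: "K < \<nu>" and nz: "(\<Sum>n=1..N. chi (int n)) \<noteq> 0"
  shows "is_pole (q_L q \<nu> chi) (of_nat (\<nu> - K))"
proof -
  define a :: complex where "a = of_nat (\<nu> - K)"
  have a: "a = of_nat \<nu> - of_nat K" "Re a = real \<nu> - real K" using K by (auto simp: a_def of_nat_diff)
  have "a \<noteq> - of_nat j" for j
  proof
    assume "a = - of_nat j"
    hence "Re a = - real j" by simp
    thus False using a(2) K by linarith
  qed
  hence b: "rising_binomial K a \<noteq> 0" by (simp add: rising_binomial_def pochhammer_eq_0_iff)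
  have "rising_binomial K \<midarrow>a\<rightarrow> rising_binomial K a"
    by (intro isContD analytic_at_imp_isCont rising_binomial_analytic)
  hence "(\<lambda>z. rising_binomial K z * ((z - a) * char_gf N chi (node q \<nu> K z)))
     \<midarrow>a\<rightarrow> rising_binomial K a * ((\<Sum>n=1..N. chi (int n)) / of_nat N * of_real (inverse (- ln q)))"
    by (intro tendsto_mult char_gf_node_residue q a)
  moreover have "rising_binomial K a * ((\<Sum>n=1..N. chi (int n)) / of_nat N * of_real (inverse (- ln q))) \<noteq> 0"
    using b nz q modulus_pos by auto
  moreover have "filterlim (\<lambda>z. inverse (z - a)) at_infinity (at a)"
    by (rule filterlim_compose[OF filterlim_inverse_at_infinity])
       (auto simp: filterlim_at eventually_at_filter intro!: tendsto_eq_intros)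
  ultimately have "filterlim (\<lambda>z. rising_binomial K z * ((z - a) * char_gf N chi (node q \<nu> K z)) * inverse (z - a))
      at_infinity (at a)"
    by (rule tendsto_mult_filterlim_at_infinity)
  moreover have "L_rest q \<nu> K \<midarrow>a\<rightarrow> L_rest q \<nu> K a"
    by (rule isContD[OF analytic_at_imp_isCont[OF L_rest_analytic[OF q a(2)]]])
  ultimately have "filterlim (\<lambda>z. L_rest q \<nu> K z + rising_binomial K z *
      ((z - a) * char_gf N chi (node q \<nu> K z)) * inverse (z - a)) at_infinity (at a)"
    by (intro tendsto_add_filterlim_at_infinity)
  moreover have "(\<lambda>z. complex_of_real (1 - q) powr z) \<midarrow>a\<rightarrow> complex_of_real (1 - q) powr a"
    using q by (intro powr_one_minus_tendsto)
  moreover have "complex_of_real (1 - q) powr a \<noteq> 0" using q by simp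
  ultimately have "filterlim (\<lambda>z. complex_of_real (1 - q) powr z * (L_rest q \<nu> K z + rising_binomial K z *
      ((z - a) * char_gf N chi (node q \<nu> K z)) * inverse (z - a))) at_infinity (at a)"
    by (intro tendsto_mult_filterlim_at_infinity)
  moreover have "\<forall>\<^sub>F z in at a. complex_of_real (1 - q) powr z * (L_rest q \<nu> K z + rising_binomial K z *
      ((z - a) * char_gf N chi (node q \<nu> K z)) * inverse (z - a)) = L_expansion q \<nu> N chi z"
    using eventually_neq_at_within[of a a UNIV]
    by eventually_elim (simp add: L_expansion_isolate[OF q, of _ _ K] L_term_def field_simps)
  ultimately have "filterlim (L_expansion q \<nu> N chi) at_infinity (at a)"
    using filterlim_cong[OF refl refl] by (smt (verit, best) eventually_mono filterlim_cong)
  thus ?thesis unfolding is_pole_q_L_iff[OF q] unfolding is_pole_def a_def .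
qed

text \<open>The argument \<open>q\<^bsup>i Im s\<^esup>\<close> of the \<open>K\<close>-th term passes through the given point \<open>x\<close> of the circle for a
  sequence of values of \<open>q\<close> tending to \<open>0\<close>. Along this sequence that term stays constant.\<close>

lemma crystal_limit_on_line:
  assumes s: "Re s = real \<nu> - real K" "Im s \<noteq> 0" and l: "L_0_is \<nu> chi s l"
    and x: "norm x = 1" "x ^ N \<noteq> 1"
  shows "l = - chi (int N) * (\<Sum>k<K. rising_binomial k s) + rising_binomial K s * char_gf N chi x"
proof -
  define t where "t = Im s"
  define \<theta> where "\<theta> = Arg x"
  \<comment> \<open>The solutions \<open>q\<close> of \<open>t log q \<equiv> \<theta>\<close> modulo \<open>2\<pi>\<close>, in decreasing order.\<close>
  define Q where "Q j = exp (\<theta> / t - 2 * pi * real j / \<bar>t\<bar>)" for j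
  have t: "t \<noteq> 0" using s by (simp add: t_def)
  have x_eq: "x = cis \<theta>" using x rcis_cmod_Arg[of x] by (simp add: \<theta>_def rcis_def)
  have Q: "filterlim Q (at_right 0) sequentially"
    unfolding Q_def using t by real_asymp
  have node: "node (Q j) \<nu> K s = x" for j
  proof -
    have "s - of_nat \<nu> + of_nat K = \<i> * of_real t"
      using s by (simp add: complex_eq_iff t_def)
    hence "node (Q j) \<nu> K s = exp (\<i> * of_real (t * ln (Q j)))"
      by (simp add: node_def powr_of_real_exp Q_def mult.assoc)
    also have "t * ln (Q j) = \<theta> + 2 * pi * of_int (if t > 0 then - int j else int j)"
      using t by (auto simp: Q_def field_simps)
    also have "exp (\<i> * of_real \<dots>) = x"
      unfolding cis_conv_exp[symmetric] x_eq cis_mult[symmetric] by (simp add: cis_multiple_2pi)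
    finally show ?thesis .
  qed
  define F where "F q = of_real (1 - q) powr s * (L_rest q \<nu> K s + rising_binomial K s * char_gf N chi x)" for q
  have "(F \<longlongrightarrow> 1 * (- chi (int N) * (\<Sum>k<K. rising_binomial k s) + rising_binomial K s * char_gf N chi x)) (at_right 0)"
    unfolding F_def[abs_def]
    by (intro tendsto_mult tendsto_add powr_one_minus_tendsto_1 L_rest_tendsto s tendsto_const)
  from filterlim_compose[OF this Q]
  have F: "(\<lambda>j. F (Q j)) \<longlonglongrightarrow> - chi (int N) * (\<Sum>k<K. rising_binomial k s) + rising_binomial K s * char_gf N chi x"
    by simp
  have "((\<lambda>q. q_L q \<nu> chi s) \<longlongrightarrow> l) (at_right 0)" using l by (simp add: L_0_is_def has_crystal_limit_def)
  from filterlim_compose[OF this Q] have L: "(\<lambda>j. q_L (Q j) \<nu> chi s) \<longlonglongrightarrow> l" .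
  have "\<forall>\<^sub>F j in sequentially. 0 < Q j \<and> Q j < 1"
    using eventually_compose_filterlim[OF eventually_q_in_unit_interval Q] .
  hence "\<forall>\<^sub>F j in sequentially. q_L (Q j) \<nu> chi s = F (Q j)"
  proof eventually_elim
    case (elim j)
    have "node (Q j) \<nu> k s ^ N \<noteq> 1" for k
    proof (cases "k = K")
      case True
      thus ?thesis using x node by simp
    next
      case False
      thus ?thesis using elim s modulus_pos by (intro node_root_of_unity_free) auto
    qed
    thus ?case
      using elim by (simp add: q_L_eq_L_expansion F_def L_expansion_isolate[of _ _ _ K] L_term_def node)
  qed
  from Lim_transform_eventually[OF L this] show ?thesis
    using F by (rule LIMSEQ_unique)
qed

text \<open>If \<open>g\<close> were constant equal to \<open>c\<close> on the circle, the polynomial \<open>\<Sum>n=1..N. \<chi>(n) x\<^sup>n - c (1 - x\<^sup>N)\<close> would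
  have infinitely many zeros. Its value at \<open>0\<close> gives \<open>c = 0\<close>, and then its linear coefficient
  \<open>\<chi>(1) = 1\<close> is a contradiction.\<close>

lemma char_gf_not_constant_on_circle:
  assumes "\<And>x. norm x = 1 \<Longrightarrow> x ^ N \<noteq> 1 \<Longrightarrow> char_gf N chi x = c"
  shows False
proof -
  define p where "p = (\<Sum>n=1..N. monom (chi (int n)) n) + monom c N - [:c:]"
  have N: "N > 0" by (rule modulus_pos)
  have p: "poly p x = (\<Sum>n=1..N. chi (int n) * x ^ n) - c * (1 - x ^ N)" for x
    by (simp add: p_def poly_sum poly_monom algebra_simps)
  have "sphere 0 1 - {x. x ^ N = 1} \<subseteq> {x. poly p x = 0}"
  proof
    fix x :: complex assume x: "x \<in> sphere 0 1 - {x. x ^ N = 1}"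
    hence "char_gf N chi x = c" using assms by auto
    with x show "x \<in> {x. poly p x = 0}" unfolding p char_gf_def by (auto simp: field_simps)
  qed
  moreover have "infinite (sphere 0 1 - {x::complex. x ^ N = 1})"
  proof -
    have "infinite (sphere (0::complex) 1)" 
      by (intro uncountable_infinite connected_uncountable[of _ 1 "-1"] connected_sphere) auto
    moreover have "finite {x::complex. x ^ N = 1}" using N by (intro finite_roots_unity) auto
    ultimately show ?thesis by simp
  qed
  ultimately have "p = 0" using poly_roots_finite[of p] finite_subset by blast
  hence "poly p 0 = 0" by simp
  hence "c = 0" using N unfolding p by (simp add: power_0_left)
  have "coeff p 1 = (\<Sum>n=1..N. if n = 1 then chi (int n) else 0)"
    by (simp add: p_def coeff_sum \<open>c = 0\<close>)
  also have "\<dots> = chi 1" using N by (simp add: sum.delta)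
  finally show False using \<open>p = 0\<close> chi_one by simp
qed

lemma principal_character_sum_nonzero:
  assumes "principal_character N chi"
  shows "(\<Sum>n=1..N. chi (int n)) \<noteq> 0"
proof -
  have chi01: "chi a = 1 \<or> chi a = 0" for a
    using assms chi unfolding principal_character_def dirichlet_character_def by blast
  have "Re (chi (int 1)) \<le> (\<Sum>n=1..N. Re (chi (int n)))"
  proof (rule member_le_sum)
    show "Re (chi (int n)) \<ge> 0" for n using chi01[of "int n"] by auto
  qed (use modulus_pos in auto)
  hence "Re (\<Sum>n=1..N. chi (int n)) \<ge> 1" using chi_one by simp
  thus ?thesis by (metis not_one_le_zero zero_complex.sel(1))
qed

lemma no_crystal_limit:
  assumes dom: "s \<notin> crystal_domain \<nu>" and exc: "s \<notin> exceptional_points \<nu> N chi"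
  shows "\<not> L_0_is \<nu> chi s l"
proof
  assume l: "L_0_is \<nu> chi s l"
  from dom obtain i where i: "Re s = of_int i" "i \<le> int \<nu>" by (auto simp: crystal_domain_def)
  from dom have nonpos: "s \<noteq> - of_nat j" for j by (auto simp: crystal_domain_def)
  define K where "K = nat (int \<nu> - i)"
  have K: "Re s = real \<nu> - real K" "i = int \<nu> - int K" using i by (auto simp: K_def)
  show False
  proof (cases "Im s = 0")
    case False
    have b: "rising_binomial K s \<noteq> 0" using nonpos by (simp add: rising_binomial_def pochhammer_eq_0_iff)
    show False
    proof (rule char_gf_not_constant_on_circle)
      fix x :: complex assume "norm x = 1" "x ^ N \<noteq> 1"
      from crystal_limit_on_line[OF K(1) False l this]
      show "char_gf N chi x = (l + chi (int N) * (\<Sum>k<K. rising_binomial k s)) / rising_binomial K s"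
        using b by (simp add: field_simps)
    qed
  next
    case True
    have "K < \<nu>"
    proof (rule ccontr)
      assume "\<not> K < \<nu>"
      hence "s = - of_nat (K - \<nu>)" using True K(1) by (simp add: complex_eq_iff of_nat_diff)
      thus False using nonpos by blast
    qed
    hence s: "s = of_nat (\<nu> - K)" "\<nu> - K \<in> {1..\<nu>}"
      using True K(1) by (auto simp: complex_eq_iff of_nat_diff)
    have "principal_character N chi"
      using exc s by (metis exceptional_points_def imageI)
    hence pole: "is_pole (q_L q \<nu> chi) s" if "0 < q" "q < 1" for q
      unfolding s(1) using that \<open>K < \<nu>\<close> by (intro is_pole_q_L principal_character_sum_nonzero)
    have "\<forall>\<^sub>F q in at_right 0. \<not> is_pole (q_L q \<nu> chi) s"
      using l by (simp add: L_0_is_def has_crystal_limit_def)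
    hence "\<forall>\<^sub>F q::real in at_right 0. False"
      using eventually_q_in_unit_interval by eventually_elim (use pole in auto)
    thus False by simp
  qed
qed

end

section \<open>The crystal functions\<close>

theorem proposition2p10:
  fixes \<nu> N m :: nat and chi :: "int \<Rightarrow> complex"
  assumes "\<nu> > 0"
    and "dirichlet_character N chi"
  shows "(chi \<noteq> trivial_character \<longrightarrow> L_0_is \<nu> chi (- of_nat m) 0) \<and>
    zeta_0_is \<nu> (- of_nat m) (if m = 0 then - 1 else 0) \<and>
    (\<forall>s \<in> crystal_domain \<nu>.
       (chi \<noteq> trivial_character \<longrightarrow> L_0_is \<nu> chi s 0) \<and>
       (Re s > real \<nu> \<longrightarrow> zeta_0_is \<nu> s 0) \<and>
       (\<forall>k::nat. real \<nu> - real k - 1 < Re s \<and> Re s < real \<nu> - real k \<longrightarrow>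
          zeta_0_is \<nu> s (- (pochhammer (s + 1) k / fact k)))) \<and>
    (\<forall>s. s \<notin> crystal_domain \<nu> \<longrightarrow> s \<notin> exceptional_points \<nu> N chi \<longrightarrow>
       \<not> (\<exists>l. L_0_is \<nu> chi s l))"
proof -
  have zeta: "zeta_0_is \<nu> s l \<longleftrightarrow> L_0_is \<nu> trivial_character s l" for s l
    by (simp add: zeta_0_is_def L_0_is_def q_zeta_def)
  have triv: "dirichlet_character 1 trivial_character"
    by (simp add: dirichlet_character_def trivial_character_def)
  have chi_N: "chi (int N) = 0" if "chi \<noteq> trivial_character"
  proof -
    have "N \<noteq> 1"
    proof
      assume "N = 1"
      have "chi a = chi 0" for a
      proof (induction a rule: int_induct[where k = 0])
        case (step2 i)
        thus ?case using chi_periodic[OF assms(2), of "i - 1"] \<open>N = 1\<close> by simp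
      qed (use chi_periodic[OF assms(2)] \<open>N = 1\<close> in auto)
      hence "chi a = 1" for a using chi_one[OF assms(2)] by metis
      with that show False by (auto simp: trivial_character_def)
    qed
    thus ?thesis using chi_modulus[OF assms(2)] by simp
  qed
  have strip: "\<exists>M. real \<nu> - real M < Re s \<and> (M > 0 \<longrightarrow> Re s < real \<nu> - real M + 1)"
    if "Re s \<notin> real_of_int ` {..int \<nu>}" for s
  proof (cases "Re s > real \<nu>")
    case False
    \<comment> \<open>The lines \<open>Re s = \<nu> - k\<close> with \<open>k < M\<close> are those to the right of \<open>s\<close>.\<close>
    define M where "M = nat (int \<nu> - \<lfloor>Re s\<rfloor>)"
    have "\<lfloor>Re s\<rfloor> \<le> int \<nu>" using False by linarith
    moreover from this have "Re s \<noteq> of_int \<lfloor>Re s\<rfloor>" using that by force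
    ultimately show ?thesis
      by (intro exI[of _ M]) (auto simp: M_def, linarith+)
  qed (auto intro: exI[of _ 0])
  show ?thesis
  proof (intro conjI impI ballI allI)
    show "L_0_is \<nu> chi (- of_nat m) 0" if "chi \<noteq> trivial_character"
      using crystal_limit_nonpos_int[OF assms(2,1)] chi_N[OF that] by simp
    show "zeta_0_is \<nu> (- of_nat m) (if m = 0 then - 1 else 0)"
      using crystal_limit_nonpos_int[OF triv assms(1), of m]
      by (simp add: zeta trivial_character_def split: if_splits)
    show "L_0_is \<nu> chi s 0" if "s \<in> crystal_domain \<nu>" "chi \<noteq> trivial_character" for s
    proof (cases "Re s \<in> real_of_int ` {..int \<nu>}")
      case True
      with that(1) obtain j where "s = - of_nat j" by (auto simp: crystal_domain_def)
      thus ?thesis using crystal_limit_nonpos_int[OF assms(2,1), of j] chi_N[OF that(2)] by simp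
    next
      case False
      then obtain M where "real \<nu> - real M < Re s" "M > 0 \<Longrightarrow> Re s < real \<nu> - real M + 1"
        using strip by blast
      from crystal_limit_open_strip[OF assms(2) this] chi_N[OF that(2)] show ?thesis by simp
    qed
    show "zeta_0_is \<nu> s 0" if "Re s > real \<nu>" for s
      using crystal_limit_open_strip[OF triv, of \<nu> 0 s] that by (simp add: zeta)
    show "zeta_0_is \<nu> s (- (pochhammer (s + 1) k / fact k))"
      if "real \<nu> - real k - 1 < Re s \<and> Re s < real \<nu> - real k" for s k
    proof -
      have "L_0_is \<nu> trivial_character s (- trivial_character (int 1) * (\<Sum>j<Suc k. rising_binomial j s))"
        using that by (intro crystal_limit_open_strip[OF triv]) auto
      thus ?thesis
        unfolding lessThan_Suc_atMost sum_rising_binomial zeta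
        by (simp add: trivial_character_def rising_binomial_def)
    qed
    show "\<not> (\<exists>l. L_0_is \<nu> chi s l)"
      if "s \<notin> crystal_domain \<nu>" "s \<notin> exceptional_points \<nu> N chi" for s
      using no_crystal_limit[OF assms(2) that] by blast
  qed
qed

end
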